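(* Consider the many-server system, the revenue rate $R_s(\gamma)$, the compact interval $\Gamma=[\gamma_l,\gamma_r]$, the exact optimizer $\gamma_s^{\mathrm{opt}}$ and the approximate optimizers $\gamma_{j,s}$ described in the context, under all assumptions listed there. For $j=0,1,\ldots$, there exist constants $M_j$ and $K_j$ independent of $s$, and $s_j\in\mathbb{N}_+$, such that for all $s\ge s_j$, $$ \bigl| R_s(\gamma_s^{\mathrm{opt}}) - R_s(\gamma_{j,s}) \bigr| \le \frac{q_s M_j}{s^{(j+1)/2}}, \qquad \bigl| \gamma_{j,s}-\gamma_s^{\mathrm{opt}} \bigr| \le \frac{K_j}{s^{(j+1)/2}} . $$
   Context: Model. For each integer $s\ge1$ consider a system with $s$ parallel servers, Poisson arrivals of rate $\lambda$, and exponential service times with mean one. A customer who arrives and finds $k-s\ge 0$ customers waiting ($k$ being the number of customers in the system) is allowed to join the queue with probability $p_s(k-s)$ and is rejected with probability $1-p_s(k-s)$. Put $\rho=\lambda/s$ and $F_s(\rho)=\sum_{n=0}^\infty p_s(0)\cdots p_s(n)\rho^{n+1}$. The stationary distribution of the number of customers in the system exists if and only if $F_s(\rho)<\infty$, and is then $\pi_s(k)=Z^{-1}(s\rho)^k/k!$ for $0\le k\le s$ and $\pi_s(k)=Z^{-1}\frac{s^s\rho^k}{s!}\prod_{i=0}^{k-s-1}p_s(i)$ for $k>s$, where $Z=\sum_{k=0}^s (s\rho)^k/k!+\frac{(s\rho)^s}{s!}F_s(\rho)$. The system generates revenue at rate $r_s(k)\in\mathbb{R}$ when $k$ customers are present,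 and the stationary revenue rate is $R_s(\gamma)=\sum_{k=0}^\infty r_s(k)\pi_s(k)$, where $\gamma$ is the parameter in condition (i). Scaling conditions (as $s\to\infty$). (i) $\lambda=s-\gamma\sqrt s$. (ii) $p_s(0)\cdots p_s(n)\to f((n+1)/\sqrt s)$, where $f(x)$ is either a continuous, nonincreasing function, or $f(x)=\mathbf 1[x\le\eta]$. (iii) There exist sequences $\{n_s\}_{s\in\mathbb{N}_+}$ and $\{q_s\}_{s\in\mathbb{N}_+}$ with $q_s>0$, and a continuous function $r(x)$, such that $(r_s(k)-n_s)/q_s\to r((k-s)/\sqrt s)$. Assumption on $f$. $\lim_{\gamma\downarrow\gamma^{\min}}\int_0^\infty f(x)e^{-\gamma x}\,dx=\infty$, where $\gamma^{\min}=\inf\{\gamma\in\mathbb{R}:\int_0^\infty f(x)e^{-\gamma x}\,dx<\infty\}$. Interval. $\Gamma=[\gamma_l,\gamma_r]$ is a compact interval contained in $(\gamma_s^{\min},\infty)$, where $\gamma_s^{\min}=\inf\{\gamma\in\mathbb{R}: F_s(\rho)<\infty\}$ with $\rho=1-\gamma/\sqrt s$. Expansion assumption. Asymptotic expansions as $s\to\infty$ are available for $R_s(\gamma)$ and its derivative $R_s'(\gamma)$, with coefficient functions $R_0,R_1,\ldots$ not depending on $s$: $R_s(\gamma)=n_s+q_s\bigl(\sum_{i=0}^{j+1}R_i(\gamma)s^{-i/2}+O(s^{-(j+2)/2})\bigr)$ and $R_s'(\gamma)=q_s\bigl(\sum_{i=0}^{j+1}R_i'(\gamma)s^{-i/2}+O(s^{-(j+2)/2})\bigr)$.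 Regularity assumptions. $R_0^{(k)},\ldots,R_j^{(k)}$ are bounded on $\Gamma$ for $k=0,1,2$, and $R_{j+1}^{(l)}$ is bounded on $\Gamma$ for $l=0,1$ (superscripts denote derivatives in $\gamma$). The function $R_0$ is strictly concave on $\Gamma$, with $R_0''$ continuous on $\Gamma$ and $R_0''(\gamma)<0$ for all $\gamma\in\Gamma$. Optimizers. $\gamma_s^{\mathrm{opt}}=\arg\max_{\gamma\in\Gamma}R_s(\gamma)$ and $\gamma_{j,s}=\arg\max_{\gamma\in\Gamma}\bigl\{R_0(\gamma)+\cdots+R_j(\gamma)s^{-j/2}\bigr\}$; $\gamma_0=\gamma_{0,s}$ is independent of $s$. It is assumed that $\gamma_0$ and $\gamma_s^{\mathrm{opt}}$ exist, are unique, and lie in the interior of $\Gamma$. *)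

theory Defs
  imports "HOL-Analysis.Analysis"
begin

text \<open>
  Throughout, \<open>p s n\<close> is the probability that a customer finding \<open>n\<close> waiting customers is
  admitted to the system with \<open>s\<close> servers, and \<open>r s k\<close> is the revenue rate with \<open>k\<close> customers
  present. The value \<open>s = 0\<close> carries no meaning.
\<close>

definition arrival_rate :: "nat \<Rightarrow> real \<Rightarrow> real" where
  "arrival_rate s \<gamma> = real s - \<gamma> * sqrt (real s)"

definition load :: "nat \<Rightarrow> real \<Rightarrow> real" where
  "load s \<gamma> = arrival_rate s \<gamma> / real s"

definition F_term :: "(nat \<Rightarrow> nat \<Rightarrow> real) \<Rightarrow> nat \<Rightarrow> real \<Rightarrow> nat \<Rightarrow> real" where
  "F_term p s \<rho> n = (\<Prod>i\<le>n. p s i) * \<rho> ^ (n + 1)"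

definition F :: "(nat \<Rightarrow> nat \<Rightarrow> real) \<Rightarrow> nat \<Rightarrow> real \<Rightarrow> real" where
  "F p s \<rho> = (\<Sum>n. F_term p s \<rho> n)"

text \<open>
  For \<open>\<rho> \<ge> 0\<close> the terms are nonnegative, so that \<open>F\<^sub>s(\<rho>) < \<infinity>\<close> means summability.
\<close>

definition F_finite :: "(nat \<Rightarrow> nat \<Rightarrow> real) \<Rightarrow> nat \<Rightarrow> real \<Rightarrow> bool" where
  "F_finite p s \<rho> \<longleftrightarrow> summable (F_term p s \<rho>)"

definition norm_const :: "(nat \<Rightarrow> nat \<Rightarrow> real) \<Rightarrow> nat \<Rightarrow> real \<Rightarrow> real" where
  "norm_const p s \<rho> =
     (\<Sum>k\<le>s. (real s * \<rho>) ^ k / fact k) + (real s * \<rho>) ^ s / fact s * F p s \<rho>"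

definition stationary :: "(nat \<Rightarrow> nat \<Rightarrow> real) \<Rightarrow> nat \<Rightarrow> real \<Rightarrow> nat \<Rightarrow> real" where
  "stationary p s \<rho> k =
     (if k \<le> s then (real s * \<rho>) ^ k / fact k
      else real s ^ s * \<rho> ^ k / fact s * (\<Prod>i<k - s. p s i)) / norm_const p s \<rho>"

text \<open>
  The two lemmas below tie this formula to the queue: it is a normalised solution of the balance
  equations of the birth-death process with birth rate \<open>\<lambda>\<close> in states \<open>k < s\<close>,
  birth rate \<open>\<lambda> p s (k - s)\<close> in states \<open>k \<ge> s\<close>, and death rate \<open>min k s\<close>.
\<close>

lemma stationary_balance:
  assumes "s \<ge> 1"
  shows "stationary p s \<rho> k * (real s * \<rho> * (if k < s then 1 else p s (k - s)))
           = stationary p s \<rho> (Suc k) * real (min (Suc k) s)"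
proof -
  consider "k < s" | "k = s" | "k > s" by linarith
  then show ?thesis
  proof cases
    case 1
    then show ?thesis by (simp add: stationary_def min_def field_simps del: of_nat_Suc)
  next
    case 2
    then show ?thesis by (simp add: stationary_def field_simps power_mult_distrib)
  next
    case 3
    then have "Suc k - s = Suc (k - s)" by simp
    with 3 show ?thesis by (simp add: stationary_def field_simps)
  qed
qed

lemma stationary_sums_1:
  assumes "0 \<le> \<rho>" "\<And>n. 0 \<le> p s n" "F_finite p s \<rho>"
  shows "stationary p s \<rho> sums 1"
proof -
  define w where "w k = (if k \<le> s then (real s * \<rho>) ^ k / fact k
      else real s ^ s * \<rho> ^ k / fact s * (\<Prod>i<k - s. p s i))" for k
  have "w (n + Suc s) = (real s * \<rho>) ^ s / fact s * F_term p s \<rho> n" for n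
    by (simp add: w_def F_term_def power_add power_mult_distrib lessThan_Suc_atMost field_simps)
  moreover have "(\<lambda>n. (real s * \<rho>) ^ s / fact s * F_term p s \<rho> n)
      sums ((real s * \<rho>) ^ s / fact s * F p s \<rho>)"
    using assms(3) unfolding F_finite_def F_def by (intro sums_mult summable_sums)
  ultimately have "(\<lambda>n. w (n + Suc s)) sums ((real s * \<rho>) ^ s / fact s * F p s \<rho>)"
    by simp
  then have "w sums ((real s * \<rho>) ^ s / fact s * F p s \<rho> + (\<Sum>k<Suc s. w k))"
    by (simp only: sums_iff_shift)
  moreover have "(\<Sum>k<Suc s. w k) = (\<Sum>k\<le>s. (real s * \<rho>) ^ k / fact k)"
    unfolding lessThan_Suc_atMost by (intro sum.cong) (auto simp: w_def)
  ultimately have "w sums norm_const p s \<rho>"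
    by (simp add: norm_const_def add.commute)
  then have "(\<lambda>k. w k / norm_const p s \<rho>) sums (norm_const p s \<rho> / norm_const p s \<rho>)"
    by (rule sums_divide)
  moreover have "norm_const p s \<rho> > 0"
  proof -
    have "(\<Sum>k\<le>s. (real s * \<rho>) ^ k / fact k) > 0"
      using assms(1) by (intro sum_pos2[where i = 0]) auto
    moreover have "F p s \<rho> \<ge> 0"
      using assms unfolding F_def F_finite_def
      by (intro suminf_nonneg) (auto simp: F_term_def intro!: mult_nonneg_nonneg prod_nonneg)
    ultimately show ?thesis using assms(1) by (auto simp: norm_const_def intro!: add_pos_nonneg)
  qed
  ultimately show ?thesis by (simp add: w_def stationary_def[abs_def])
qed

definition revenue_term ::
  "(nat \<Rightarrow> nat \<Rightarrow> real) \<Rightarrow> (nat \<Rightarrow> nat \<Rightarrow> real) \<Rightarrow> nat \<Rightarrow> real \<Rightarrow> nat \<Rightarrow> real" where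
  "revenue_term p r s \<gamma> k = r s k * stationary p s (load s \<gamma>) k"

definition revenue :: "(nat \<Rightarrow> nat \<Rightarrow> real) \<Rightarrow> (nat \<Rightarrow> nat \<Rightarrow> real) \<Rightarrow> nat \<Rightarrow> real \<Rightarrow> real" where
  "revenue p r s \<gamma> = (\<Sum>k. revenue_term p r s \<gamma> k)"

text \<open>
  The thresholds are extended reals, because they can be \<open>-\<infinity>\<close> (for instance for finite buffers).
  Those \<open>\<gamma>\<close> that make \<open>\<rho>\<close> negative do not affect the first infimum, since \<open>\<gamma> = sqrt s\<close>,
  that is \<open>\<rho> = 0\<close>, always belongs to the set.
\<close>

definition gamma_min_s :: "(nat \<Rightarrow> nat \<Rightarrow> real) \<Rightarrow> nat \<Rightarrow> ereal" where
  "gamma_min_s p s = Inf (ereal ` {\<gamma>. F_finite p s (load s \<gamma>)})"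

definition laplace :: "(real \<Rightarrow> real) \<Rightarrow> real \<Rightarrow> ennreal" where
  "laplace f \<gamma> = (\<integral>\<^sup>+x\<in>{0..}. ennreal (f x * exp (- \<gamma> * x)) \<partial>lborel)"

definition gamma_min :: "(real \<Rightarrow> real) \<Rightarrow> ereal" where
  "gamma_min f = Inf (ereal ` {\<gamma>. laplace f \<gamma> < \<infinity>})"

text \<open>
  The statement \<open>a\<^sub>s(k) \<longlongrightarrow> g(x\<^sub>s(k))\<close> as \<open>s \<longlongrightarrow> \<infinity>\<close>, where \<open>k\<close> varies with \<open>s\<close>, is read as:
  \<open>a\<^sub>s(k\<^sub>s) \<longlongrightarrow> g(y)\<close> whenever the scaled indices \<open>x\<^sub>s(k\<^sub>s)\<close> converge to a point \<open>y\<close> of \<open>Y\<close>.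
\<close>

definition scaling_limit ::
  "(nat \<Rightarrow> nat \<Rightarrow> real) \<Rightarrow> (nat \<Rightarrow> nat \<Rightarrow> real) \<Rightarrow> (real \<Rightarrow> real) \<Rightarrow> real set \<Rightarrow> bool" where
  "scaling_limit x a g Y \<longleftrightarrow>
     (\<forall>y\<in>Y. \<forall>k :: nat \<Rightarrow> nat.
        (\<lambda>s. x s (k s)) \<longlonglongrightarrow> y \<longrightarrow> (\<lambda>s. a s (k s)) \<longlonglongrightarrow> g y)"

text \<open>
  Only continuity points of \<open>f\<close> are tested; this excludes just the jump \<open>\<eta>\<close> of an indicator.
\<close>

definition admission_scaling :: "(nat \<Rightarrow> nat \<Rightarrow> real) \<Rightarrow> (real \<Rightarrow> real) \<Rightarrow> bool" where
  "admission_scaling p f \<longleftrightarrow>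
     (continuous_on {0..} f \<and> antimono_on {0..} f \<or>
      (\<exists>\<eta>. \<forall>x\<ge>0. f x = of_bool (x \<le> \<eta>))) \<and>
     scaling_limit (\<lambda>s n. (real n + 1) / sqrt (real s)) (\<lambda>s n. \<Prod>i\<le>n. p s i) f
       {x. 0 \<le> x \<and> continuous (at x within {0..}) f}"

definition revenue_scaling ::
  "(nat \<Rightarrow> nat \<Rightarrow> real) \<Rightarrow> (nat \<Rightarrow> real) \<Rightarrow> (nat \<Rightarrow> real) \<Rightarrow> (real \<Rightarrow> real) \<Rightarrow> bool" where
  "revenue_scaling r n q rlim \<longleftrightarrow>
     (\<forall>s\<ge>1. 0 < q s) \<and> continuous_on UNIV rlim \<and>
     scaling_limit (\<lambda>s k. (real k - real s) / sqrt (real s)) (\<lambda>s k. (r s k - n s) / q s) rlim UNIV"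

definition strictly_concave_on :: "real set \<Rightarrow> (real \<Rightarrow> real) \<Rightarrow> bool" where
  "strictly_concave_on S g \<longleftrightarrow> convex S \<and>
     (\<forall>x\<in>S. \<forall>y\<in>S. \<forall>t. x \<noteq> y \<longrightarrow> 0 < t \<longrightarrow> t < 1 \<longrightarrow>
        (1 - t) * g x + t * g y < g ((1 - t) * x + t * y))"

definition expansion :: "(nat \<Rightarrow> real \<Rightarrow> real) \<Rightarrow> nat \<Rightarrow> nat \<Rightarrow> real \<Rightarrow> real" where
  "expansion R m s \<gamma> = (\<Sum>i\<le>m. R i \<gamma> * real s powr (- real i / 2))"

definition unique_interior_max :: "real set \<Rightarrow> (real \<Rightarrow> real) \<Rightarrow> bool" where
  "unique_interior_max S g \<longleftrightarrow>
     (\<exists>!x. is_arg_max g (\<lambda>x. x \<in> S) x) \<and> arg_max_on g S \<in> interior S"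

end

theory Submission
  imports Defs
begin

text \<open>
  Write \<open>E\<close> for the truncated expansion \<open>R\<^sub>0 + \<dots> + R\<^sub>j s\<^bsup>-j/2\<^esup>\<close>, \<open>a\<close> for its maximiser on \<open>\<Gamma>\<close> and
  \<open>b\<close> for the maximiser of the true revenue rate. The proof is a perturbation argument for the
  first-order condition, and it rests on \<open>E\<close> being strongly concave for large \<open>s\<close>.

  By compactness \<open>R\<^sub>0'' \<le> -2c\<close> on \<open>\<Gamma>\<close> for some \<open>c > 0\<close>. The higher-order terms change the second
  derivative by \<open>O(s\<^bsup>-1/2\<^esup>)\<close> only (\<open>expansion_minus_leading_term\<close>), so \<open>E'' \<le> -c\<close> on \<open>\<Gamma>\<close> once \<open>s\<close> is
  large. Since \<open>b\<close> is interior, the derivative of the revenue rate vanishes there. The expansion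
  of that derivative then gives \<open>E'(b) = O(s\<^bsup>-(j+1)/2\<^esup>)\<close>: the truncation drops a term of this
  order, and the remainder is smaller. For a function with second derivative at most \<open>-c\<close>, a
  point of slope \<open>\<delta>\<close> lies within \<open>\<bar>\<delta>\<bar> / c\<close> of the maximiser
  (\<open>maximiser_near_approximate_critical_point\<close>), whence the bound on \<open>\<bar>a - b\<bar>\<close>.

  The revenue bound follows from the first one, because the derivative of the revenue rate divided
  by \<open>q\<^sub>s\<close> is bounded on \<open>\<Gamma>\<close> uniformly in \<open>s\<close>.
\<close>

section \<open>Maximisers of functions on an interval\<close>

lemma derivative_at_maximum_nonpos_inward:
  fixes g :: "real \<Rightarrow> real"
  assumes deriv: "(g has_real_derivative D) (at a within S)"
    and S: "convex S" "a \<in> S" "y \<in> S"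
    and max: "\<And>x. x \<in> S \<Longrightarrow> g x \<le> g a"
  shows "D * (y - a) \<le> 0"
proof (rule ccontr)
  assume neg: "\<not> D * (y - a) \<le> 0"
  then consider "y > a" "D > 0" | "y < a" "D < 0"
    by (metis diff_gt_0_iff_gt diff_less_0_iff_less not_le zero_less_mult_iff)
  then show False
  proof cases
    case 1
    obtain d where d: "d > 0" "\<And>h. 0 < h \<Longrightarrow> a + h \<in> S \<Longrightarrow> h < d \<Longrightarrow> g a < g (a + h)"
      using has_real_derivative_pos_inc_right[OF deriv 1(2)] by blast
    define h where "h = min (d / 2) (y - a)"
    have h: "0 < h" "h < d" "h \<le> y - a" using d(1) 1(1) by (auto simp: h_def min_def)
    have "a + h \<in> {a..y}" using h by auto
    moreover have "{a..y} \<subseteq> S"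
      using S 1(1) closed_segment_subset[of a S y] by (simp add: closed_segment_eq_real_ivl)
    ultimately have "a + h \<in> S" by blast
    with d(2)[of h] h max[of "a + h"] show False by auto
  next
    case 2
    obtain d where d: "d > 0" "\<And>h. 0 < h \<Longrightarrow> a - h \<in> S \<Longrightarrow> h < d \<Longrightarrow> g a < g (a - h)"
      using has_real_derivative_neg_dec_left[OF deriv 2(2)] by blast
    define h where "h = min (d / 2) (a - y)"
    have h: "0 < h" "h < d" "h \<le> a - y" using d(1) 2(1) by (auto simp: h_def min_def)
    have "a - h \<in> {y..a}" using h by auto
    moreover have "{y..a} \<subseteq> S"
      using S 2(1) closed_segment_subset[of y S a] by (simp add: closed_segment_eq_real_ivl)
    ultimately have "a - h \<in> S" by blast
    with d(2)[of h] h max[of "a - h"] show False by auto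
  qed
qed

text \<open>
  The mean value theorem gives \<open>(g' a - g' b) (a - b) \<le> - c (a - b)\<^sup>2\<close>, and the variational
  inequality \<open>g' a (b - a) \<le> 0\<close> for the maximiser turns this into \<open>c \<bar>a - b\<bar> \<le> \<bar>g' b\<bar>\<close>. Using the
  inequality rather than \<open>g' a = 0\<close> allows \<open>a\<close> to be an endpoint of the interval.
\<close>

lemma maximiser_near_approximate_critical_point:
  fixes g g' g'' :: "real \<Rightarrow> real"
  assumes g': "\<And>x. x \<in> {l..u} \<Longrightarrow> (g has_real_derivative g' x) (at x within {l..u})"
    and g'': "\<And>x. x \<in> {l..u} \<Longrightarrow> (g' has_real_derivative g'' x) (at x within {l..u})"
    and curv: "\<And>x. x \<in> {l..u} \<Longrightarrow> g'' x \<le> - c" and c: "0 < c"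
    and a: "a \<in> {l..u}" "\<And>x. x \<in> {l..u} \<Longrightarrow> g x \<le> g a"
    and b: "b \<in> {l..u}"
  shows "\<bar>a - b\<bar> \<le> \<bar>g' b\<bar> / c"
proof -
  have mono: "g' y - g' x \<le> - c * (y - x)" if "x \<le> y" "x \<in> {l..u}" "y \<in> {l..u}" for x y
  proof -
    have sub: "{x..y} \<subseteq> {l..u}" using that by auto
    have "\<exists>z\<in>{x..y}. g' y - g' x = (\<lambda>h. h * g'' z) (y - x)"
    proof (rule mvt_very_simple[OF that(1)])
      fix z assume "x \<le> z" "z \<le> y"
      then have "(g' has_real_derivative g'' z) (at z within {x..y})"
        using sub by (intro DERIV_subset[OF g'' sub]) auto
      then show "(g' has_derivative (\<lambda>h. h * g'' z)) (at z within {x..y})"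
        by (simp add: has_field_derivative_def mult.commute[of _ "g'' z"])
    qed
    then obtain z where z: "z \<in> {x..y}" "g' y - g' x = (y - x) * g'' z" by auto
    have "(y - x) * g'' z \<le> (y - x) * (- c)"
      using curv[of z] z(1) sub that(1) by (intro mult_left_mono) auto
    with z(2) show ?thesis by (simp add: mult.commute)
  qed
  have foc: "g' a * (b - a) \<le> 0"
    using derivative_at_maximum_nonpos_inward[OF g'[OF a(1)] _ a(1) b a(2)] by simp
  consider "a < b" | "a = b" | "b < a" by linarith
  then have "c * \<bar>a - b\<bar> \<le> \<bar>g' b\<bar>"
  proof cases
    case 1
    then have "g' a \<le> 0" using foc by (simp add: mult_le_0_iff)
    then show ?thesis using mono[of a b] 1 a(1) b by (simp add: algebra_simps)
  next
    case 3
    then have "0 \<le> g' a" using foc by (simp add: mult_le_0_iff)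
    then show ?thesis using mono[of b a] 3 a(1) b by (simp add: algebra_simps)
  qed auto
  then show ?thesis using c by (simp add: field_simps)
qed

lemma is_arg_max_arg_max_on:
  assumes "is_arg_max g (\<lambda>x. x \<in> S) x"
  shows "is_arg_max g (\<lambda>x. x \<in> S) (arg_max_on g S)"
  using someI[of "is_arg_max g (\<lambda>x. x \<in> S)", OF assms] by (simp only: arg_max_on_def arg_max_def)

lemma arg_max_on_compact:
  fixes g :: "real \<Rightarrow> real"
  assumes "compact S" "S \<noteq> {}" "continuous_on S g"
  shows "arg_max_on g S \<in> S" "\<And>x. x \<in> S \<Longrightarrow> g x \<le> g (arg_max_on g S)"
proof -
  obtain x where "x \<in> S" "\<forall>y\<in>S. g y \<le> g x"
    using continuous_attains_sup[OF assms] by blast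
  then have "is_arg_max g (\<lambda>x. x \<in> S) x" by (auto simp: is_arg_max_linorder)
  then have "is_arg_max g (\<lambda>x. x \<in> S) (arg_max_on g S)"
    by (rule is_arg_max_arg_max_on)
  then show "arg_max_on g S \<in> S" "\<And>x. x \<in> S \<Longrightarrow> g x \<le> g (arg_max_on g S)"
    by (auto simp: is_arg_max_linorder)
qed

lemma derivative_zero_at_interior_maximum:
  fixes g :: "real \<Rightarrow> real"
  assumes deriv: "\<And>x. x \<in> S \<Longrightarrow> (g has_real_derivative g' x) (at x within S)"
    and max: "unique_interior_max S g"
  shows "g' (arg_max_on g S) = 0"
proof -
  let ?b = "arg_max_on g S"
  obtain x where "is_arg_max g (\<lambda>x. x \<in> S) x" and int: "?b \<in> interior S"
    using max unfolding unique_interior_max_def by blast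
  then have "is_arg_max g (\<lambda>x. x \<in> S) ?b" by (intro is_arg_max_arg_max_on)
  then have b: "?b \<in> S" "\<And>x. x \<in> S \<Longrightarrow> g x \<le> g ?b"
    by (auto simp: is_arg_max_linorder)
  have "(g has_real_derivative g' ?b) (at ?b)"
    using deriv[OF b(1)] unfolding at_within_interior[OF int] .
  moreover obtain e where e: "e > 0" "ball ?b e \<subseteq> S"
    using int unfolding mem_interior by blast
  moreover have "g y \<le> g ?b" if "\<bar>?b - y\<bar> < e" for y
  proof -
    have "y \<in> ball ?b e" using that by (simp add: dist_real_def)
    with e(2) show ?thesis by (intro b(2)) (rule subsetD)
  qed
  ultimately show ?thesis using DERIV_local_max[of g "g' ?b" ?b e] by simp
qed

section \<open>Truncated expansions\<close>

lemma expansion_Suc: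
  "expansion R (Suc m) s x = expansion R m s x + R (Suc m) x * real s powr (- real (Suc m) / 2)"
  by (simp only: expansion_def sum.atMost_Suc)

lemma expansion_has_real_derivative:
  assumes "\<And>i. i \<le> m \<Longrightarrow> (R i has_real_derivative R' i x) (at x within S)"
  shows "(expansion R m s has_real_derivative expansion R' m s x) (at x within S)"
  unfolding expansion_def[abs_def] using assms
  by (intro DERIV_sum DERIV_cmult_right) auto

lemma uniform_coefficient_bound:
  fixes R :: "nat \<Rightarrow> real \<Rightarrow> real"
  assumes "\<And>i. i \<le> m \<Longrightarrow> bounded (R i ` S)"
  obtains B where "0 \<le> B" "\<And>i x. i \<le> m \<Longrightarrow> x \<in> S \<Longrightarrow> \<bar>R i x\<bar> \<le> B"
proof -
  have "bounded (\<Union>i\<le>m. R i ` S)" using assms by (intro bounded_UN) auto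
  then obtain B where "0 < B" "\<forall>y\<in>(\<Union>i\<le>m. R i ` S). norm y \<le> B" unfolding bounded_pos by blast
  then show thesis by (intro that[of B]) auto
qed

text \<open>Every term after the zeroth carries a factor \<open>s\<^bsup>-i/2\<^esup> \<le> s\<^bsup>-1/2\<^esup>\<close>.\<close>

lemma expansion_minus_leading_term:
  assumes B: "\<And>i. i \<le> m \<Longrightarrow> \<bar>R i x\<bar> \<le> B" and s: "s \<ge> 1"
  shows "\<bar>expansion R m s x - R 0 x\<bar> \<le> real m * B * real s powr (- 1 / 2)"
proof -
  have "expansion R m s x - R 0 x = (\<Sum>i=1..m. R i x * real s powr (- real i / 2))"
    using s by (simp add: expansion_def atMost_atLeast0 sum.atLeast_Suc_atMost)
  also have "\<bar>\<dots>\<bar> \<le> (\<Sum>i=1..m. \<bar>R i x * real s powr (- real i / 2)\<bar>)" by (rule sum_abs)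
  also have "\<dots> \<le> (\<Sum>i=1..m. B * real s powr (- 1 / 2))"
  proof (intro sum_mono)
    fix i assume i: "i \<in> {1..m}"
    have "real s powr (- real i / 2) \<le> real s powr (- 1 / 2)"
      using i s by (intro powr_mono) auto
    then show "\<bar>R i x * real s powr (- real i / 2)\<bar> \<le> B * real s powr (- 1 / 2)"
      using B[of i] i by (auto simp: abs_mult intro!: mult_mono)
  qed
  finally show ?thesis by simp
qed

section \<open>Accuracy of the approximate optimiser\<close>

theorem theorem1:
  fixes p r :: "nat \<Rightarrow> nat \<Rightarrow> real"
    and f rlim :: "real \<Rightarrow> real"
    and n q :: "nat \<Rightarrow> real"
    and \<gamma>l \<gamma>r :: real
    and \<Gamma> :: "real set"
    and R R' R'' :: "nat \<Rightarrow> real \<Rightarrow> real"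
    and Rs' :: "nat \<Rightarrow> real \<Rightarrow> real"
    and j :: nat
  assumes prob: "\<And>s k. s \<ge> 1 \<Longrightarrow> 0 \<le> p s k \<and> p s k \<le> 1"
    and adm: "admission_scaling p f"
    and rev: "revenue_scaling r n q rlim"
    and lap: "(laplace f \<longlongrightarrow> \<infinity>) (filtercomap ereal (at_right (gamma_min f)))"
    and Gamma: "\<gamma>l \<le> \<gamma>r" "\<Gamma> = {\<gamma>l..\<gamma>r}"
    and stable: "\<forall>\<^sub>F s in sequentially. \<forall>\<gamma>\<in>\<Gamma>. gamma_min_s p s < ereal \<gamma>"
    and conv: "\<forall>\<^sub>F s in sequentially. \<forall>\<gamma>\<in>\<Gamma>. summable (revenue_term p r s \<gamma>)"
    and R_deriv: "\<And>i \<gamma>. i \<le> j + 1 \<Longrightarrow> \<gamma> \<in> \<Gamma> \<Longrightarrow>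
                    (R i has_real_derivative R' i \<gamma>) (at \<gamma> within \<Gamma>)"
    and R'_deriv: "\<And>i \<gamma>. i \<le> j \<Longrightarrow> \<gamma> \<in> \<Gamma> \<Longrightarrow>
                    (R' i has_real_derivative R'' i \<gamma>) (at \<gamma> within \<Gamma>)"
    and Rs_deriv: "\<forall>\<^sub>F s in sequentially. \<forall>\<gamma>\<in>\<Gamma>.
                    (revenue p r s has_real_derivative Rs' s \<gamma>) (at \<gamma> within \<Gamma>)"
    and expand: "\<exists>C. \<forall>\<^sub>F s in sequentially. \<forall>\<gamma>\<in>\<Gamma>.
                   \<bar>revenue p r s \<gamma> - (n s + q s * expansion R (j + 1) s \<gamma>)\<bar>
                     \<le> q s * (C * real s powr (- (real j + 2) / 2))"
    and expand': "\<exists>C. \<forall>\<^sub>F s in sequentially. \<forall>\<gamma>\<in>\<Gamma>.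
                   \<bar>Rs' s \<gamma> - q s * expansion R' (j + 1) s \<gamma>\<bar>
                     \<le> q s * (C * real s powr (- (real j + 2) / 2))"
    and bdd: "\<And>i. i \<le> j \<Longrightarrow> bounded (R i ` \<Gamma>) \<and> bounded (R' i ` \<Gamma>) \<and> bounded (R'' i ` \<Gamma>)"
    and bdd_last: "bounded (R (j + 1) ` \<Gamma>) \<and> bounded (R' (j + 1) ` \<Gamma>)"
    and concave: "strictly_concave_on \<Gamma> (R 0)"
    and R0''_cont: "continuous_on \<Gamma> (R'' 0)"
    and R0''_neg: "\<And>\<gamma>. \<gamma> \<in> \<Gamma> \<Longrightarrow> R'' 0 \<gamma> < 0"
    and opt0: "unique_interior_max \<Gamma> (R 0)"
    and opt_s: "\<forall>\<^sub>F s in sequentially. unique_interior_max \<Gamma> (revenue p r s)"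
  shows "\<exists>M K. \<exists>s\<^sub>j\<ge>1. \<forall>s\<ge>s\<^sub>j.
           (let \<gamma>opt = arg_max_on (revenue p r s) \<Gamma>;
                \<gamma>app = arg_max_on (expansion R j s) \<Gamma>
            in \<bar>revenue p r s \<gamma>opt - revenue p r s \<gamma>app\<bar>
                   \<le> q s * M / real s powr ((real j + 1) / 2)
               \<and> \<bar>\<gamma>app - \<gamma>opt\<bar> \<le> K / real s powr ((real j + 1) / 2))"
proof -
  have \<Gamma>: "compact \<Gamma>" "\<Gamma> \<noteq> {}" "convex \<Gamma>" using Gamma by auto

  \<comment> \<open>The factor two leaves room for the corrections of order \<open>s\<^bsup>-1/2\<^esup>\<close> to the second derivative.\<close>
  obtain c where c: "0 < c" "\<And>x. x \<in> \<Gamma> \<Longrightarrow> R'' 0 x \<le> - (2 * c)"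
  proof -
    obtain x0 where "x0 \<in> \<Gamma>" "\<forall>x\<in>\<Gamma>. R'' 0 x \<le> R'' 0 x0"
      using continuous_attains_sup[OF \<Gamma>(1,2) R0''_cont] by blast
    then show thesis using R0''_neg by (intro that[of "- R'' 0 x0 / 2"]) auto
  qed
  obtain B2 where B2: "0 \<le> B2" "\<And>i x. i \<le> j \<Longrightarrow> x \<in> \<Gamma> \<Longrightarrow> \<bar>R'' i x\<bar> \<le> B2"
    using uniform_coefficient_bound[of j R'' \<Gamma>] bdd by blast
  obtain B1 where B1: "0 \<le> B1" "\<And>i x. i \<le> j + 1 \<Longrightarrow> x \<in> \<Gamma> \<Longrightarrow> \<bar>R' i x\<bar> \<le> B1"
  proof -
    have "bounded (R' i ` \<Gamma>)" if "i \<le> j + 1" for i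
      using that bdd[of i] bdd_last by (cases "i = j + 1") auto
    then show thesis using that uniform_coefficient_bound[of "j + 1" R' \<Gamma>] by blast
  qed
  obtain C where C: "\<forall>\<^sub>F s in sequentially. \<forall>\<gamma>\<in>\<Gamma>. \<bar>Rs' s \<gamma> - q s * expansion R' (j + 1) s \<gamma>\<bar>
      \<le> q s * (C * real s powr (- (real j + 2) / 2))"
    using expand' by blast

  have "(\<lambda>s. real j * B2 * real s powr (- 1 / 2)) \<longlonglongrightarrow> real j * B2 * 0"
    by (intro tendsto_mult_left tendsto_neg_powr filterlim_real_sequentially) auto
  then have small: "\<forall>\<^sub>F s in sequentially. real j * B2 * real s powr (- 1 / 2) < c"
    using c(1) by (intro order_tendstoD(2)[where y = "real j * B2 * 0"]) auto

  \<comment> \<open>\<open>(B1 + \<bar>C\<bar>) s\<^bsup>-(j+1)/2\<^esup>\<close> will bound the slope of the truncated expansion at the true optimiser,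
    and \<open>q s * L\<close> the derivative of the revenue rate on \<open>\<Gamma>\<close>.\<close>
  define K where "K = (B1 + \<bar>C\<bar>) / c"
  define L where "L = (real j + 2) * B1 + \<bar>C\<bar>"
  have L: "0 \<le> L" using B1(1) by (simp add: L_def)

  have "\<forall>\<^sub>F s in sequentially. s \<ge> 1 \<and>
      \<bar>revenue p r s (arg_max_on (revenue p r s) \<Gamma>)
         - revenue p r s (arg_max_on (expansion R j s) \<Gamma>)\<bar>
        \<le> q s * (L * K) / real s powr ((real j + 1) / 2) \<and>
      \<bar>arg_max_on (expansion R j s) \<Gamma> - arg_max_on (revenue p r s) \<Gamma>\<bar>
        \<le> K / real s powr ((real j + 1) / 2)"
    using small C Rs_deriv opt_s eventually_ge_at_top[of 1]
  proof eventually_elim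
    case (elim s)
    define a where "a = arg_max_on (expansion R j s) \<Gamma>"
    define b where "b = arg_max_on (revenue p r s) \<Gamma>"
    define \<epsilon> where "\<epsilon> = real s powr (- (real j + 1) / 2)"
    have q: "0 < q s" using rev elim(5) by (simp add: revenue_scaling_def)
    have \<epsilon>: "0 < \<epsilon>" using elim(5) by (simp add: \<epsilon>_def)
    have "\<epsilon> = 1 / real s powr ((real j + 1) / 2)"
      unfolding \<epsilon>_def by (metis minus_divide_left powr_minus_divide)
    then have \<epsilon>_inverse: "x / real s powr ((real j + 1) / 2) = x * \<epsilon>" for x by simp
    have remainder: "C * real s powr (- (real j + 2) / 2) \<le> \<bar>C\<bar> * \<epsilon>"
      unfolding \<epsilon>_def using elim(5) by (intro mult_mono powr_mono) auto

    have E': "(expansion R j s has_real_derivative expansion R' j s x) (at x within \<Gamma>)"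
      if "x \<in> \<Gamma>" for x using R_deriv that by (intro expansion_has_real_derivative) auto
    have E'': "(expansion R' j s has_real_derivative expansion R'' j s x) (at x within \<Gamma>)"
      if "x \<in> \<Gamma>" for x using R'_deriv that by (intro expansion_has_real_derivative) auto
    have curv: "expansion R'' j s x \<le> - c" if "x \<in> \<Gamma>" for x
      using expansion_minus_leading_term[of j R'' x B2 s] B2(2) c(2) that elim(1,5) by fastforce

    have "continuous_on \<Gamma> (expansion R j s)"
      using E' by (intro DERIV_continuous_on) auto
    note a = arg_max_on_compact[OF \<Gamma>(1,2) this, folded a_def]
    have b: "b \<in> \<Gamma>"
      using elim(4) interior_subset unfolding b_def unique_interior_max_def by blast
    have "Rs' s b = 0"
      unfolding b_def using elim(3,4) by (intro derivative_zero_at_interior_maximum) auto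
    then have "q s * \<bar>expansion R' (j + 1) s b\<bar> \<le> q s * (C * real s powr (- (real j + 2) / 2))"
      using elim(2) b q by (force simp: abs_mult)
    then have "\<bar>expansion R' (j + 1) s b\<bar> \<le> \<bar>C\<bar> * \<epsilon>"
      using q remainder by (simp add: mult_le_cancel_left_pos)
    moreover have "\<bar>R' (j + 1) b * \<epsilon>\<bar> \<le> B1 * \<epsilon>"
      using B1(2)[of "j + 1" b] b \<epsilon> by (simp add: abs_mult)
    ultimately have slope: "\<bar>expansion R' j s b\<bar> \<le> (B1 + \<bar>C\<bar>) * \<epsilon>"
      by (simp add: expansion_Suc \<epsilon>_def distrib_right add.commute)

    have "\<bar>a - b\<bar> \<le> \<bar>expansion R' j s b\<bar> / c"
      by (rule maximiser_near_approximate_critical_point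
              [where g'' = "expansion R'' j s", OF E'[unfolded Gamma(2)] E''[unfolded Gamma(2)]])
         (use curv a b c(1) in \<open>simp_all add: Gamma(2)\<close>)
    also have "\<dots> \<le> K * \<epsilon>"
      using slope c(1) by (simp add: K_def divide_right_mono)
    finally have close: "\<bar>a - b\<bar> \<le> K * \<epsilon>" .

    have "\<bar>Rs' s x\<bar> \<le> q s * L" if x: "x \<in> \<Gamma>" for x
    proof -
      have "\<epsilon> \<le> 1" "real s powr (- 1 / 2) \<le> 1"
        using elim(5) powr_mono[of _ 0 "real s"] by (auto simp: \<epsilon>_def)
      then have "\<bar>C\<bar> * \<epsilon> \<le> \<bar>C\<bar>"
        "real (j + 1) * B1 * real s powr (- 1 / 2) \<le> real (j + 1) * B1"
        using B1(1) by (auto intro!: mult_left_le)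
      moreover have "\<bar>expansion R' (j + 1) s x - R' 0 x\<bar> \<le> real (j + 1) * B1 * real s powr (- 1 / 2)"
        using B1(2) x elim(5) by (intro expansion_minus_leading_term) auto
      moreover have "\<bar>R' 0 x\<bar> \<le> B1" using B1(2) x by simp
      ultimately have "\<bar>expansion R' (j + 1) s x\<bar> + C * real s powr (- (real j + 2) / 2) \<le> L"
        using remainder by (simp add: L_def algebra_simps)
      then have "q s * \<bar>expansion R' (j + 1) s x\<bar> + q s * (C * real s powr (- (real j + 2) / 2))
          \<le> q s * L"
        unfolding distrib_left[symmetric] using q by (intro mult_left_mono) auto
      moreover have "\<bar>q s * expansion R' (j + 1) s x\<bar> = q s * \<bar>expansion R' (j + 1) s x\<bar>"
        using q by (simp add: abs_mult)
      moreover have "\<bar>Rs' s x - q s * expansion R' (j + 1) s x\<bar>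
          \<le> q s * (C * real s powr (- (real j + 2) / 2))"
        using elim(2) x by blast
      ultimately show ?thesis by linarith
    qed
    then have "\<bar>revenue p r s b - revenue p r s a\<bar> \<le> q s * L * \<bar>b - a\<bar>"
      using field_differentiable_bound[OF \<Gamma>(3), of "revenue p r s" "Rs' s" "q s * L" b a]
        elim(3) a(1) b by simp
    also have "\<dots> \<le> q s * L * (K * \<epsilon>)"
      using close q L by (intro mult_left_mono) (auto simp: abs_minus_commute)
    finally show ?case
      using close elim(5) by (simp add: \<epsilon>_inverse a_def b_def mult.assoc)
  qed
  then obtain s0 where s0: "\<forall>s\<ge>s0. s \<ge> 1 \<and>
      \<bar>revenue p r s (arg_max_on (revenue p r s) \<Gamma>)
         - revenue p r s (arg_max_on (expansion R j s) \<Gamma>)\<bar>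
        \<le> q s * (L * K) / real s powr ((real j + 1) / 2) \<and>
      \<bar>arg_max_on (expansion R j s) \<Gamma> - arg_max_on (revenue p r s) \<Gamma>\<bar>
        \<le> K / real s powr ((real j + 1) / 2)"
    unfolding eventually_sequentially by blast
  show ?thesis
    unfolding Let_def
  proof (rule exI[of _ "L * K"], rule exI[of _ K], rule exI[of _ s0], intro conjI allI impI)
    show "1 \<le> s0" using s0[rule_format, of s0] by simp
  qed (use s0 in \<open>auto simp only:\<close>)
qed

end
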